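(* Let $\{\mathcal G,\Gamma_0,\Gamma_1\}$ be a quasi boundary triple for $T\subset A^*$ with $A_0=T\upharpoonright\ker\Gamma_0$, assume that there exists $\eta\in\rho(A_0)\cap\mathbb R$ and that $\mathscr G_1=\operatorname{ran}(\Gamma_1\upharpoonright\ker\Gamma_0)$ is dense in $\mathcal G$. Then the triple $\{\mathcal G,\Upsilon_0,\Upsilon_1\}$ with boundary mappings $\Upsilon_0,\Upsilon_1:\operatorname{dom}A^*\to\mathcal G$ given by $$\Upsilon_0f:=\iota_-\widetilde\Gamma_0f,\qquad \Upsilon_1f:=\iota_+\Gamma_1f_0,\qquad f=f_0+f_\eta\in\operatorname{dom}A_0\,\dot{+}\,\mathcal N_\eta(A^* )=\operatorname{dom}A^*,$$ is an ordinary boundary triple for $A^*$ with $$A^*\upharpoonright\ker\Upsilon_0=A_0\qquad\text{and}\qquad A^*\upharpoonright\ker\Upsilon_1=A\,\dot{+}\,\widehat{\mathcal N}_\eta(A^* ).$$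
   Context: Inner products are linear in the first and antilinear in the second argument. $\mathcal H$ is a separable Hilbert space, $A$ is a closed, densely defined, symmetric operator in $\mathcal H$ with adjoint $A^*$. Quasi boundary triple: let $T\subset A^*$ be a linear operator in $\mathcal H$ with $\overline T=A^*$. A triple $\{\mathcal G,\Gamma_0,\Gamma_1\}$ is a quasi boundary triple for $T\subset A^*$ if $\mathcal G$ is a Hilbert space and $\Gamma_0,\Gamma_1:\operatorname{dom}T\to\mathcal G$ are linear maps such that (a) $(Tf,g)_{\mathcal H}-(f,Tg)_{\mathcal H}=(\Gamma_1f,\Gamma_0g)_{\mathcal G}-(\Gamma_0f,\Gamma_1g)_{\mathcal G}$ for all $f,g\in\operatorname{dom}T$; (b) $\Gamma=(\Gamma_0,\Gamma_1)^\top:\operatorname{dom}T\to\mathcal G\times\mathcal G$ has dense range; (c) $A_0:=T\upharpoonright\ker\Gamma_0$ is self-adjoint in $\mathcal H$. If $T=A^*$, a quasi boundary triple is called an ordinary boundary triple for $A^*$. Notation: $\mathcal N_\eta(A^* )=\ker(A^*-\eta)$ and $\widehat{\mathcal N}_\eta(A^* )=\{(f_\eta,\eta f_\eta)^\top:f_\eta\in\mathcal N_\eta(A^* )\}$; for $\eta\in\rho(A_0)$, $\operatorname{dom}A^*=\operatorname{dom}A_0\,\dot{+}\,\mathcal N_\eta(A^* )$ (direct sum). Operators are identified with their graphs, and $A\,\dot{+}\,\widehat{\mathcal N}_\eta(A^* )$ is the direct sum of subspaces of $\mathcal H\times\mathcal H$. The space $\mathscr G_1$ is equipped with a norm $\|\cdot\|_{\mathscr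 G_1}$ such that $\mathscr G_1$ is a reflexive Banach space continuously embedded in $\mathcal G$ and $\Gamma_1(A_0-\bar\lambda)^{-1}:\mathcal H\to\mathscr G_1$ is continuous for some (equivalently all) $\lambda\in\rho(A_0)$ (such a norm exists when $\mathscr G_1$ is dense, and all such norms are equivalent). $\mathscr G_1'$ is the anti-dual of $\mathscr G_1$ (continuous antilinear functionals), with $\mathscr G_1\hookrightarrow\mathcal G\hookrightarrow\mathscr G_1'$ and pairing $\langle\cdot,\cdot\rangle_{\mathscr G_1'\times\mathscr G_1}$ extending $(\cdot,\cdot)_{\mathcal G}$. $\widetilde\Gamma_0:\operatorname{dom}A^*\to\mathscr G_1'$ is the unique extension of $\Gamma_0$ that is continuous with respect to the graph norm of $A^*$ (it exists and is surjective). $\iota_+:\mathscr G_1\to\mathcal G$ and $\iota_-:\mathscr G_1'\to\mathcal G$ are isometric isomorphisms with $(\iota_-x',\iota_+x)_{\mathcal G}=\langle x',x\rangle_{\mathscr G_1'\times\mathscr G_1}$ for all $x\in\mathscr G_1$, $x'\in\mathscr G_1'$. *)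

theory Defs
  imports "HOL-Analysis.Analysis" "HOL-Library.Function_Algebras"
begin

section \<open>Complex vector, normed and Hilbert spaces\<close>

class complex_vector = ab_group_add +
  fixes scaleC :: "complex \<Rightarrow> 'a \<Rightarrow> 'a"  (infixr \<open>*\<^sub>C\<close> 75)
  assumes scaleC_add_right: "a *\<^sub>C (x + y) = a *\<^sub>C x + a *\<^sub>C y"
    and scaleC_add_left: "(a + b) *\<^sub>C x = a *\<^sub>C x + b *\<^sub>C x"
    and scaleC_scaleC: "a *\<^sub>C b *\<^sub>C x = (a * b) *\<^sub>C x"
    and scaleC_one: "1 *\<^sub>C x = x"

interpretation complex_vector:
  vector_space "scaleC :: complex \<Rightarrow> 'a \<Rightarrow> 'a::complex_vector"
  by unfold_locales (simp_all add: scaleC_add_right scaleC_add_left scaleC_scaleC scaleC_one)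

abbreviation csubspace :: "'a::complex_vector set \<Rightarrow> bool"
  where "csubspace \<equiv> complex_vector.subspace"

class complex_normed_vector = complex_vector + real_normed_vector +
  assumes scaleR_scaleC: "r *\<^sub>R x = complex_of_real r *\<^sub>C x"
    and norm_scaleC: "norm (a *\<^sub>C x) = cmod a * norm x"

text \<open>Inner products are linear in the first and antilinear in the second argument.\<close>

class complex_inner = complex_normed_vector +
  fixes cinner :: "'a \<Rightarrow> 'a \<Rightarrow> complex"
  assumes cinner_commute: "cinner x y = cnj (cinner y x)"
    and cinner_add_left: "cinner (x + y) z = cinner x z + cinner y z"
    and cinner_scaleC_left: "cinner (a *\<^sub>C x) y = a * cinner x y"
    and cinner_self_nonneg: "0 \<le> Re (cinner x x)"
    and norm_eq_sqrt_cinner: "norm x = sqrt (Re (cinner x x))"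

class chilbert_space = complex_inner + complete_space

instantiation complex :: chilbert_space
begin
definition scaleC_complex :: "complex \<Rightarrow> complex \<Rightarrow> complex"
  where "scaleC_complex a x = a * x"
definition cinner_complex :: "complex \<Rightarrow> complex \<Rightarrow> complex"
  where "cinner_complex x y = x * cnj y"
instance
  by standard
    (simp_all add: scaleC_complex_def cinner_complex_def distrib_left distrib_right
      scaleR_conv_of_real norm_mult complex_norm_square [symmetric])
end

instantiation prod :: (complex_vector, complex_vector) complex_vector
begin
definition scaleC_prod :: "complex \<Rightarrow> 'a \<times> 'b \<Rightarrow> 'a \<times> 'b"
  where "scaleC_prod a p = (a *\<^sub>C fst p, a *\<^sub>C snd p)"
instance
  by standard
    (auto simp: scaleC_prod_def scaleC_add_right scaleC_add_left scaleC_scaleC scaleC_one prod_eq_iff)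
end

instantiation "fun" :: (type, complex_vector) complex_vector
begin
definition scaleC_fun :: "complex \<Rightarrow> ('a \<Rightarrow> 'b) \<Rightarrow> 'a \<Rightarrow> 'b"
  where "scaleC_fun a f = (\<lambda>x. a *\<^sub>C f x)"
instance
  by standard
    (auto simp: scaleC_fun_def scaleC_add_right scaleC_add_left scaleC_scaleC scaleC_one fun_eq_iff)
end


section \<open>Normed spaces on a carrier, anti-duals\<close>

text \<open>
  The space \<open>\<G>\<^sub>1\<close> is a subspace of a Hilbert space with its own norm. Such spaces are therefore
  given by a carrier set in an ambient complex vector space together with a norm function, of
  which only the values on the carrier matter.
\<close>

definition clinear_on :: "'a::complex_vector set \<Rightarrow> ('a \<Rightarrow> 'b::complex_vector) \<Rightarrow> bool"
  where "clinear_on X f \<longleftrightarrow>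
    (\<forall>x\<in>X. \<forall>y\<in>X. f (x + y) = f x + f y) \<and> (\<forall>a. \<forall>x\<in>X. f (a *\<^sub>C x) = a *\<^sub>C f x)"

definition antilinear_on :: "'a::complex_vector set \<Rightarrow> ('a \<Rightarrow> 'b::complex_vector) \<Rightarrow> bool"
  where "antilinear_on X f \<longleftrightarrow>
    (\<forall>x\<in>X. \<forall>y\<in>X. f (x + y) = f x + f y) \<and> (\<forall>a. \<forall>x\<in>X. f (a *\<^sub>C x) = cnj a *\<^sub>C f x)"

definition norm_on :: "'a::complex_vector set \<Rightarrow> ('a \<Rightarrow> real) \<Rightarrow> bool"
  where "norm_on X n \<longleftrightarrow> csubspace X \<and>
    (\<forall>x\<in>X. 0 \<le> n x) \<and> (\<forall>x\<in>X. n x = 0 \<longleftrightarrow> x = 0) \<and>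
    (\<forall>x\<in>X. \<forall>y\<in>X. n (x + y) \<le> n x + n y) \<and> (\<forall>a. \<forall>x\<in>X. n (a *\<^sub>C x) = cmod a * n x)"

definition banach_on :: "'a::complex_vector set \<Rightarrow> ('a \<Rightarrow> real) \<Rightarrow> bool"
  where "banach_on X n \<longleftrightarrow> norm_on X n \<and>
    (\<forall>s::nat \<Rightarrow> 'a. range s \<subseteq> X \<longrightarrow>
      (\<forall>e>0. \<exists>N. \<forall>i\<ge>N. \<forall>j\<ge>N. n (s i - s j) < e) \<longrightarrow>
      (\<exists>x\<in>X. (\<lambda>i. n (s i - x)) \<longlonglongrightarrow> 0))"

definition continuous_between ::
  "'a::complex_vector set \<Rightarrow> ('a \<Rightarrow> real) \<Rightarrow> 'b::complex_vector set \<Rightarrow> ('b \<Rightarrow> real) \<Rightarrow> ('a \<Rightarrow> 'b) \<Rightarrow> bool"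
  where "continuous_between X nX Y nY f \<longleftrightarrow> f ` X \<subseteq> Y \<and>
    (\<forall>x\<in>X. \<forall>e>0. \<exists>d>0. \<forall>y\<in>X. nX (y - x) < d \<longrightarrow> nY (f y - f x) < e)"

text \<open>
  Continuous antilinear functionals on \<open>X\<close>. They are required to vanish outside of \<open>X\<close>, so that
  functionals which agree on \<open>X\<close> are equal as functions.
\<close>

definition antidual :: "'a::complex_vector set \<Rightarrow> ('a \<Rightarrow> real) \<Rightarrow> ('a \<Rightarrow> complex) set"
  where "antidual X n =
    {\<phi>. antilinear_on X \<phi> \<and> continuous_between X n UNIV cmod \<phi> \<and> (\<forall>x. x \<notin> X \<longrightarrow> \<phi> x = 0)}"

definition antidual_norm :: "'a::complex_vector set \<Rightarrow> ('a \<Rightarrow> real) \<Rightarrow> ('a \<Rightarrow> complex) \<Rightarrow> real"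
  where "antidual_norm X n \<phi> = (SUP x\<in>{x\<in>X. n x \<le> 1}. cmod (\<phi> x))"

text \<open>
  The bidual is the anti-dual of the anti-dual; \<open>x \<mapsto> (\<phi> \<mapsto> cnj (\<phi> x))\<close> is the canonical (linear)
  embedding into it.
\<close>

definition reflexive_on :: "'a::complex_vector set \<Rightarrow> ('a \<Rightarrow> real) \<Rightarrow> bool"
  where "reflexive_on X n \<longleftrightarrow>
    (\<forall>\<Phi>\<in>antidual (antidual X n) (antidual_norm X n). \<exists>x\<in>X. \<forall>\<phi>\<in>antidual X n. \<Phi> \<phi> = cnj (\<phi> x))"

definition isometric_isomorphism ::
  "'a::complex_vector set \<Rightarrow> ('a \<Rightarrow> real) \<Rightarrow> 'b::complex_vector set \<Rightarrow> ('b \<Rightarrow> real) \<Rightarrow> ('a \<Rightarrow> 'b) \<Rightarrow> bool"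
  where "isometric_isomorphism X nX Y nY f \<longleftrightarrow>
    clinear_on X f \<and> bij_betw f X Y \<and> (\<forall>x\<in>X. nY (f x) = nX x)"

text \<open>The embedding of a Hilbert space into the anti-dual of a subspace \<open>X\<close>: \<open>y \<mapsto> (y, \<cdot>)\<close>.\<close>

definition antidual_embed :: "'g::complex_inner set \<Rightarrow> 'g \<Rightarrow> 'g \<Rightarrow> complex"
  where "antidual_embed X y = (\<lambda>x. if x \<in> X then cinner y x else 0)"

definition is_direct_sum :: "'a::complex_vector set \<Rightarrow> 'a set \<Rightarrow> 'a set \<Rightarrow> bool"
  where "is_direct_sum W U V \<longleftrightarrow> U \<inter> V = {0} \<and> W = {u + v | u v. u \<in> U \<and> v \<in> V}"


section \<open>Operators in a Hilbert space\<close>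

text \<open>Operators are identified with their graphs; \<^const>\<open>Domain\<close> is the domain of the operator.\<close>

type_synonym 'h oper = "('h \<times> 'h) set"

definition linear_operator :: "'h::complex_vector oper \<Rightarrow> bool"
  where "linear_operator S \<longleftrightarrow> csubspace S \<and> single_valued S"

definition op_apply :: "'h oper \<Rightarrow> 'h \<Rightarrow> 'h"
  where "op_apply S f = (THE f'. (f, f') \<in> S)"

definition densely_defined :: "'h::complex_inner oper \<Rightarrow> bool"
  where "densely_defined S \<longleftrightarrow> closure (Domain S) = UNIV"

definition adjoint_op :: "'h::complex_inner oper \<Rightarrow> 'h oper"
  where "adjoint_op S = {(g, g'). \<forall>(f, f')\<in>S. cinner f' g = cinner f g'}"

definition symmetric_op :: "'h::complex_inner oper \<Rightarrow> bool"
  where "symmetric_op S \<longleftrightarrow> S \<subseteq> adjoint_op S"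

definition selfadjoint_op :: "'h::complex_inner oper \<Rightarrow> bool"
  where "selfadjoint_op S \<longleftrightarrow> linear_operator S \<and> densely_defined S \<and> adjoint_op S = S"

definition shift_op :: "'h::complex_vector oper \<Rightarrow> complex \<Rightarrow> 'h oper"
  where "shift_op S z = {(f, f' - z *\<^sub>C f) | f f'. (f, f') \<in> S}"

definition resolvent :: "'h::complex_vector oper \<Rightarrow> complex \<Rightarrow> 'h \<Rightarrow> 'h"
  where "resolvent S z h = (THE f. (f, h) \<in> shift_op S z)"

definition resolvent_set :: "'h::complex_normed_vector oper \<Rightarrow> complex set"
  where "resolvent_set S =
    {z. (\<forall>h. \<exists>!f. (f, h) \<in> shift_op S z) \<and> continuous_between UNIV norm UNIV norm (resolvent S z)}"

definition eigenspace :: "'h::complex_vector oper \<Rightarrow> complex \<Rightarrow> 'h set"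
  where "eigenspace S z = {f. (f, 0) \<in> shift_op S z}"

definition eigenspace_graph :: "'h::complex_vector oper \<Rightarrow> complex \<Rightarrow> 'h oper"
  where "eigenspace_graph S z = {(f, z *\<^sub>C f) | f. f \<in> eigenspace S z}"

definition graph_norm :: "'h::complex_normed_vector oper \<Rightarrow> 'h \<Rightarrow> real"
  where "graph_norm S f = norm (f, op_apply S f)"

definition restrict_ker :: "'h oper \<Rightarrow> ('h \<Rightarrow> 'g::zero) \<Rightarrow> 'h oper"
  where "restrict_ker S \<Gamma> = {(f, f'). (f, f') \<in> S \<and> \<Gamma> f = 0}"


section \<open>Quasi boundary triples and ordinary boundary triples\<close>

text \<open>
  A boundary map on the domain of an operator is given by a total function, of which only the
  values on that domain matter.
\<close>

definition quasi_boundary_triple ::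
  "'h::chilbert_space oper \<Rightarrow> 'h oper \<Rightarrow> ('h \<Rightarrow> 'g::chilbert_space) \<Rightarrow> ('h \<Rightarrow> 'g) \<Rightarrow> bool"
  where "quasi_boundary_triple A T \<Gamma>\<^sub>0 \<Gamma>\<^sub>1 \<longleftrightarrow>
    linear_operator T \<and> T \<subseteq> adjoint_op A \<and> closure T = adjoint_op A \<and>
    clinear_on (Domain T) \<Gamma>\<^sub>0 \<and> clinear_on (Domain T) \<Gamma>\<^sub>1 \<and>
    (\<forall>(f, f')\<in>T. \<forall>(g, g')\<in>T.
      cinner f' g - cinner f g' = cinner (\<Gamma>\<^sub>1 f) (\<Gamma>\<^sub>0 g) - cinner (\<Gamma>\<^sub>0 f) (\<Gamma>\<^sub>1 g)) \<and>
    closure ((\<lambda>f. (\<Gamma>\<^sub>0 f, \<Gamma>\<^sub>1 f)) ` Domain T) = UNIV \<and>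
    selfadjoint_op (restrict_ker T \<Gamma>\<^sub>0)"

definition ordinary_boundary_triple ::
  "'h::chilbert_space oper \<Rightarrow> ('h \<Rightarrow> 'g::chilbert_space) \<Rightarrow> ('h \<Rightarrow> 'g) \<Rightarrow> bool"
  where "ordinary_boundary_triple A \<Gamma>\<^sub>0 \<Gamma>\<^sub>1 \<longleftrightarrow> quasi_boundary_triple A (adjoint_op A) \<Gamma>\<^sub>0 \<Gamma>\<^sub>1"

text \<open>
  Admissible norms on \<open>\<G>\<^sub>1\<close>: reflexive Banach space norms for which the inclusion into \<open>\<G>\<close> and
  \<open>\<Gamma>\<^sub>1 (A\<^sub>0 - cnj \<lambda>)\<^sup>-\<^sup>1\<close> for some \<open>\<lambda>\<close> in the resolvent set of \<open>A\<^sub>0\<close> are continuous.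
\<close>

definition admissible_norm ::
  "'h::chilbert_space oper \<Rightarrow> ('h \<Rightarrow> 'g::chilbert_space) \<Rightarrow> 'g set \<Rightarrow> ('g \<Rightarrow> real) \<Rightarrow> bool"
  where "admissible_norm A\<^sub>0 \<Gamma>\<^sub>1 G\<^sub>1 n\<^sub>1 \<longleftrightarrow>
    banach_on G\<^sub>1 n\<^sub>1 \<and> reflexive_on G\<^sub>1 n\<^sub>1 \<and>
    continuous_between G\<^sub>1 n\<^sub>1 UNIV norm (\<lambda>x. x) \<and>
    (\<exists>z\<in>resolvent_set A\<^sub>0.
      continuous_between UNIV norm G\<^sub>1 n\<^sub>1 (\<lambda>h. \<Gamma>\<^sub>1 (resolvent A\<^sub>0 (cnj z) h)))"

text \<open>
  \<open>\<Gamma>'\<close> is a continuous extension of \<open>\<Gamma>\<^sub>0\<close> to the domain of \<open>A\<^sup>*\<close>. Since \<open>T\<close> is dense in the graph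
  of \<open>A\<^sup>*\<close>, such an extension is uniquely determined on the domain of \<open>A\<^sup>*\<close>.
\<close>

definition continuous_extension ::
  "'h::chilbert_space oper \<Rightarrow> 'h oper \<Rightarrow> ('h \<Rightarrow> 'g::chilbert_space) \<Rightarrow> 'g set \<Rightarrow> ('g \<Rightarrow> real) \<Rightarrow>
    ('h \<Rightarrow> 'g \<Rightarrow> complex) \<Rightarrow> bool"
  where "continuous_extension A T \<Gamma>\<^sub>0 G\<^sub>1 n\<^sub>1 \<Gamma>' \<longleftrightarrow>
    (\<forall>f\<in>Domain T. \<Gamma>' f = antidual_embed G\<^sub>1 (\<Gamma>\<^sub>0 f)) \<and>
    continuous_between (Domain (adjoint_op A)) (graph_norm (adjoint_op A))
      (antidual G\<^sub>1 n\<^sub>1) (antidual_norm G\<^sub>1 n\<^sub>1) \<Gamma>'"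

text \<open>The component \<open>u\<close> in a decomposition \<open>f = u + v\<close> with \<open>u \<in> U\<close> and \<open>v \<in> V\<close>.\<close>

definition first_component :: "'a::complex_vector set \<Rightarrow> 'a set \<Rightarrow> 'a \<Rightarrow> 'a"
  where "first_component U V f = (THE u. u \<in> U \<and> f - u \<in> V)"

end

theory Submission
  imports Defs
begin

text \<open>
  Write a prime for the action of \<open>A\<^sup>*\<close>. The whole argument rests on one formula: for \<open>f \<in> dom A\<^sup>*\<close>
  and \<open>u \<in> dom A\<^sub>0\<close>, the functional \<open>\<Gamma>\<^sub>0' f\<close> takes the value \<open>(f, u') - (f', u)\<close> at \<open>\<Gamma>\<^sub>1 u\<close>
  (\<open>extended_boundary_map_formula\<close>). For \<open>f \<in> dom T\<close> this is the abstract Green identity with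
  \<open>\<Gamma>\<^sub>0 u = 0\<close>; the general case follows since \<open>T\<close> is dense in \<open>A\<^sup>*\<close> and \<open>\<Gamma>\<^sub>0'\<close> is continuous in the
  graph norm. Through the duality of \<open>\<iota>m\<close> and \<open>\<iota>p\<close> it becomes
  \<open>(\<Upsilon>\<^sub>0 f, \<iota>p (\<Gamma>\<^sub>1 u)) = (f, u') - (f', u)\<close>, and the vectors \<open>\<iota>p (\<Gamma>\<^sub>1 u)\<close> exhaust \<open>\<G>\<close>. This determines
  \<open>\<Upsilon>\<^sub>0\<close>, and all properties of the new triple can be read off:

  \<^item> \<^emph>\<open>Linearity of \<open>\<Upsilon>\<^sub>0\<close>.\<close> The right-hand side is linear in \<open>(f, f')\<close>.
  \<^item> \<^emph>\<open>Kernel of \<open>\<Upsilon>\<^sub>0\<close>.\<close> \<open>\<Upsilon>\<^sub>0 f = 0\<close> says that \<open>(f, f') \<in> A\<^sub>0\<^sup>*\<close>, that is, \<open>(f, f') \<in> A\<^sub>0\<close>.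
  \<^item> \<^emph>\<open>Green identity.\<close> With \<open>f = u + f\<^sub>\<eta>\<close> and \<open>g = v + g\<^sub>\<eta>\<close>, the left-hand side reduces to the mixed
    terms because \<open>A\<^sub>0\<close> is symmetric and \<open>\<eta>\<close> is real (\<open>green_identity_decomposed\<close>). By the formula these
    are the boundary terms, as \<open>\<Upsilon>\<^sub>1 f = \<iota>p (\<Gamma>\<^sub>1 u)\<close>.
  \<^item> \<^emph>\<open>Dense range.\<close> Let \<open>(a, b)\<close> be orthogonal to the range. On \<open>dom A\<^sub>0\<close> the map \<open>\<Upsilon>\<^sub>0\<close> vanishes while
    \<open>\<Upsilon>\<^sub>1\<close> is onto \<open>\<G>\<close>, so \<open>b = 0\<close>. Write \<open>a = \<iota>p x\<close>. On \<open>dom T\<close> the product \<open>(\<Upsilon>\<^sub>0 f, a)\<close> is \<open>(\<Gamma>\<^sub>0 f, x)\<close>,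
    and \<open>\<Gamma>\<^sub>0\<close> has dense range, so \<open>x = 0\<close>.
  \<^item> \<^emph>\<open>Kernel of \<open>\<Upsilon>\<^sub>1\<close>.\<close> \<open>\<Upsilon>\<^sub>1 f = 0\<close> says that \<open>\<Gamma>\<^sub>1 u = 0\<close>, and the elements of \<open>A\<^sub>0\<close> with this
    property form \<open>A\<close> (\<open>minimal_operator_eq\<close>), so that \<open>f\<close> is in \<open>dom A\<close> up to \<open>f\<^sub>\<eta>\<close>. The sum is direct
    because \<open>\<eta>\<close> is not an eigenvalue of \<open>A\<^sub>0\<close>.

  Two arguments rely on completeness, through the projection theorem: a subspace with trivial
  orthogonal complement is dense, and \<open>A\<^sup>*\<^sup>* = A\<close> for the closed operator \<open>A\<close>. Both concern a product
  of Hilbert spaces, which is itself made into a Hilbert space.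
\<close>

section \<open>Inner products\<close>

lemma cinner_add_right: "cinner x (y + z) = cinner x y + cinner x (z::'a::complex_inner)"
  by (metis cinner_add_left cinner_commute complex_cnj_add)

lemma cinner_scaleC_right: "cinner x (a *\<^sub>C y) = cnj a * cinner x (y::'a::complex_inner)"
  by (metis cinner_commute cinner_scaleC_left complex_cnj_mult)

lemma cinner_zero_left [simp]: "cinner 0 (y::'a::complex_inner) = 0"
  using cinner_add_left [of 0 0 y] by simp

lemma cinner_zero_right [simp]: "cinner (x::'a::complex_inner) 0 = 0"
  using cinner_add_right [of x 0 0] by simp

lemma cinner_diff_left: "cinner (x - y) z = cinner x z - cinner y (z::'a::complex_inner)"
  using cinner_add_left [of "x - y" y z] by simp

lemma cinner_diff_right: "cinner x (y - z) = cinner x y - cinner x (z::'a::complex_inner)"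
  using cinner_add_right [of x "y - z" z] by simp

lemma cinner_minus_right: "cinner x (- y) = - cinner x (y::'a::complex_inner)"
  using cinner_diff_right [of x 0 y] by simp

lemmas cinner_simps = cinner_add_left cinner_add_right cinner_diff_left cinner_diff_right
  cinner_scaleC_left cinner_scaleC_right

lemma cinner_self: "cinner x x = complex_of_real ((norm x)\<^sup>2)" for x :: "'a::complex_inner"
proof -
  have "Im (cinner x x) = 0"
    using arg_cong [OF cinner_commute [of x x], of Im] by simp
  then show ?thesis
    by (simp add: complex_eq_iff norm_eq_sqrt_cinner cinner_self_nonneg)
qed

lemma cinner_self_eq_0_iff [simp]: "cinner x x = 0 \<longleftrightarrow> x = 0" for x :: "'a::complex_inner"
  by (simp add: cinner_self)

text \<open>Pythagoras for the orthogonal projection of \<open>x\<close> onto the line through \<open>y\<close>.\<close>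

lemma norm_projection_residual:
  fixes x y :: "'a::complex_inner"
  assumes "y \<noteq> 0"
  shows "(norm (x - (cinner x y / cinner y y) *\<^sub>C y))\<^sup>2
    = (norm x)\<^sup>2 - (cmod (cinner x y))\<^sup>2 / (norm y)\<^sup>2"
proof -
  define c where "c = cinner x y"
  define N where "N = cinner y y"
  have N: "N \<noteq> 0" "cnj N = N"
    using assms cinner_commute [of y y] by (simp_all add: N_def)
  have "cinner (x - (c / N) *\<^sub>C y) (x - (c / N) *\<^sub>C y)
      = cinner x x - cnj (c / N) * c - (c / N) * cnj c + (c / N) * cnj (c / N) * N"
    by (simp add: cinner_simps c_def N_def algebra_simps flip: cinner_commute)
  also have "\<dots> = cinner x x - (c * cnj c) / N"
    using N by simp
  finally have "complex_of_real ((norm (x - (c / N) *\<^sub>C y))\<^sup>2)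
      = complex_of_real ((norm x)\<^sup>2 - (cmod c)\<^sup>2 / (norm y)\<^sup>2)"
    by (simp add: cinner_self N_def flip: complex_norm_square)
  then show ?thesis
    by (simp only: of_real_eq_iff c_def N_def)
qed

lemma norm_cinner_le: "cmod (cinner x y) \<le> norm x * norm y" for x y :: "'a::complex_inner"
proof (cases "y = 0")
  case False
  have "(cmod (cinner x y))\<^sup>2 / (norm y)\<^sup>2 \<le> (norm x)\<^sup>2"
    by (metis norm_projection_residual [OF False] diff_ge_0_iff_ge zero_le_power2)
  then have "(cmod (cinner x y))\<^sup>2 \<le> (norm x * norm y)\<^sup>2"
    using False by (simp add: divide_le_eq power_mult_distrib)
  then show ?thesis
    by (rule power2_le_imp_le) simp
qed simp

interpretation cinner: bounded_bilinear "cinner :: 'a::complex_inner \<Rightarrow> 'a \<Rightarrow> complex"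
proof
  show "\<exists>K. \<forall>a b::'a. norm (cinner a b) \<le> norm a * norm b * K"
    using norm_cinner_le by (metis mult.right_neutral)
qed (simp_all add: cinner_simps scaleR_scaleC scaleC_complex_def)

lemmas tendsto_cinner [tendsto_intros] = cinner.tendsto
lemmas continuous_on_cinner [continuous_intros] = cinner.continuous_on

text \<open>Graphs of operators live in \<open>\<H> \<times> \<H>\<close>, so that orthogonality arguments about operators
  require the Hilbert space structure of the product.\<close>

instantiation prod :: (complex_inner, complex_inner) complex_inner
begin
definition cinner_prod :: "'a \<times> 'b \<Rightarrow> 'a \<times> 'b \<Rightarrow> complex"
  where "cinner_prod p q = cinner (fst p) (fst q) + cinner (snd p) (snd q)"
instance
proof
  fix x y z :: "'a \<times> 'b" and a :: complex and r :: real
  show "r *\<^sub>R x = complex_of_real r *\<^sub>C x"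
    by (simp add: scaleC_prod_def scaleR_prod_def scaleR_scaleC)
  show "norm (a *\<^sub>C x) = cmod a * norm x"
    by (simp add: scaleC_prod_def norm_prod_def norm_scaleC power_mult_distrib real_sqrt_mult
        flip: distrib_left)
  show "cinner x y = cnj (cinner y x)"
    by (simp add: cinner_prod_def flip: cinner_commute)
  show "cinner (x + y) z = cinner x z + cinner y z"
    by (simp add: cinner_prod_def cinner_add_left)
  show "cinner (a *\<^sub>C x) y = a * cinner x y"
    by (simp add: cinner_prod_def scaleC_prod_def cinner_scaleC_left distrib_left)
  show "0 \<le> Re (cinner x x)"
    by (simp add: cinner_prod_def cinner_self_nonneg)
  show "norm x = sqrt (Re (cinner x x))"
    by (simp add: cinner_prod_def norm_prod_def cinner_self)
qed
end

instance prod :: (chilbert_space, chilbert_space) chilbert_space ..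

lemma cinner_Pair [simp]: "cinner (a, b) (c, d) = cinner a c + cinner b d"
  by (simp add: cinner_prod_def)

lemma scaleC_Pair [simp]: "z *\<^sub>C (a, b) = (z *\<^sub>C a, z *\<^sub>C b)"
  by (simp add: scaleC_prod_def)


section \<open>Orthogonality and closures of subspaces\<close>

lemma csubspaceD:
  assumes "csubspace M"
  shows "0 \<in> M" "x \<in> M \<Longrightarrow> y \<in> M \<Longrightarrow> x + y \<in> M" "x \<in> M \<Longrightarrow> y \<in> M \<Longrightarrow> x - y \<in> M"
    "x \<in> M \<Longrightarrow> a *\<^sub>C x \<in> M"
  using assms by (auto simp: complex_vector.subspace_def intro: complex_vector.subspace_diff)

lemma parallelogram:
  "(norm (x + y))\<^sup>2 + (norm (x - y))\<^sup>2 = 2 * (norm x)\<^sup>2 + 2 * (norm y)\<^sup>2"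
  for x y :: "'a::complex_inner"
proof -
  have "complex_of_real ((norm (x + y))\<^sup>2 + (norm (x - y))\<^sup>2)
      = complex_of_real (2 * (norm x)\<^sup>2 + 2 * (norm y)\<^sup>2)"
    by (simp add: cinner_simps algebra_simps del: of_real_power flip: cinner_self)
  then show ?thesis
    by (simp only: of_real_eq_iff)
qed

text \<open>A minimizing sequence for the distance from \<open>x\<close> to \<open>M\<close> is Cauchy by the parallelogram
  identity, since the midpoint of two of its members lies in \<open>M\<close> and so is no closer to \<open>x\<close>.\<close>

lemma nearest_point_exists:
  fixes M :: "'a::chilbert_space set"
  assumes M: "csubspace M" "closed M"
  shows "\<exists>m\<in>M. \<forall>y\<in>M. norm (x - m) \<le> norm (x - y)"
proof -
  define d where "d = infdist x M"
  have ne: "M \<noteq> {}"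
    using csubspaceD(1) [OF M(1)] by blast
  have d_le: "d \<le> norm (x - y)" if "y \<in> M" for y
    using infdist_le [OF that, of x] by (simp add: d_def dist_norm)
  have d0: "0 \<le> d"
    by (simp add: d_def infdist_nonneg)
  have "\<exists>y\<in>M. norm (x - y) < d + 1 / real (Suc n)" for n
  proof -
    have "(INF a\<in>M. dist x a) < d + 1 / real (Suc n)"
      using ne by (simp add: d_def infdist_def)
    then show ?thesis
      using cINF_less_iff [OF ne bdd_below_image_dist] by (auto simp: dist_norm)
  qed
  then obtain s where s: "\<And>n. s n \<in> M" "\<And>n. norm (x - s n) < d + 1 / real (Suc n)"
    by metis
  have lim: "(\<lambda>n. norm (x - s n)) \<longlonglongrightarrow> d"
  proof (rule tendsto_sandwich [of "\<lambda>_. d" _ _ "\<lambda>n. d + 1 / real (Suc n)"])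
    show "(\<lambda>n. d + 1 / real (Suc n)) \<longlonglongrightarrow> d"
      using tendsto_add [OF tendsto_const LIMSEQ_inverse_real_of_nat, of d] by (simp add: field_simps)
  qed (use s d_le in \<open>auto intro!: always_eventually less_imp_le\<close>)
  have gap: "(norm (s i - s j))\<^sup>2 \<le> 2 * (norm (x - s i))\<^sup>2 + 2 * (norm (x - s j))\<^sup>2 - 4 * d\<^sup>2" for i j
  proof -
    have "(1/2) *\<^sub>C (s i + s j) \<in> M"
      using csubspaceD [OF M(1)] s by blast
    then have "2 * d \<le> 2 * norm (x - (1/2) *\<^sub>C (s i + s j))"
      using d_le by simp
    also have "\<dots> = norm ((2::complex) *\<^sub>C (x - (1/2) *\<^sub>C (s i + s j)))"
      by (simp only: norm_scaleC) simp
    also have "(2::complex) *\<^sub>C (x - (1/2) *\<^sub>C (s i + s j)) = (x - s i) + (x - s j)"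
    proof -
      have "(2::complex) *\<^sub>C x = x + x"
        using scaleC_add_left [of 1 1 x] by (simp add: scaleC_one)
      then show ?thesis
        by (simp add: complex_vector.scale_right_diff_distrib scaleC_scaleC scaleC_one)
    qed
    finally have "(2 * d)\<^sup>2 \<le> (norm ((x - s i) + (x - s j)))\<^sup>2"
      using d0 by (intro power_mono) auto
    then show ?thesis
      using parallelogram [of "x - s i" "x - s j"] by (simp add: norm_minus_commute)
  qed
  have "Cauchy s"
  proof (rule CauchyI)
    fix e :: real assume e: "0 < e"
    have "(\<lambda>n. (norm (x - s n))\<^sup>2) \<longlonglongrightarrow> d\<^sup>2"
      using lim by (intro tendsto_intros)
    then have "\<forall>\<^sub>F n in sequentially. (norm (x - s n))\<^sup>2 < d\<^sup>2 + e\<^sup>2 / 4"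
      using e by (intro order_tendstoD(2)) auto
    then obtain N where N: "\<And>n. n \<ge> N \<Longrightarrow> (norm (x - s n))\<^sup>2 < d\<^sup>2 + e\<^sup>2 / 4"
      by (auto simp: eventually_sequentially)
    have "norm (s i - s j) < e" if "i \<ge> N" "j \<ge> N" for i j
    proof -
      have "(norm (s i - s j))\<^sup>2 < e\<^sup>2"
        using gap [of i j] N [OF that(1)] N [OF that(2)] by simp
      then show ?thesis
        using e by (simp add: power2_less_imp_less)
    qed
    then show "\<exists>N. \<forall>i\<ge>N. \<forall>j\<ge>N. norm (s i - s j) < e"
      by blast
  qed
  then obtain m where m: "s \<longlonglongrightarrow> m"
    using Cauchy_convergent convergentD by blast
  then have "m \<in> M"
    using M(2) s(1) closed_sequentially by blast
  moreover have "norm (x - m) = d"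
    using lim m by (intro LIMSEQ_unique [of "\<lambda>n. norm (x - s n)"] tendsto_intros)
  ultimately show ?thesis
    using d_le by auto
qed

text \<open>The residual of a nearest point is orthogonal to \<open>M\<close>: otherwise adding the projection of
  the residual onto a line in \<open>M\<close> would bring the point nearer.\<close>

lemma orthogonal_projection_exists:
  fixes M :: "'a::chilbert_space set"
  assumes M: "csubspace M" "closed M"
  shows "\<exists>m\<in>M. \<forall>y\<in>M. cinner y (x - m) = 0"
proof -
  obtain m where m: "m \<in> M" "\<And>y. y \<in> M \<Longrightarrow> norm (x - m) \<le> norm (x - y)"
    using nearest_point_exists [OF M] by blast
  define r where "r = x - m"
  have "cinner y r = 0" if y: "y \<in> M" for y
  proof (cases "y = 0")
    case False
    define t where "t = cinner r y / cinner y y"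
    have "m + t *\<^sub>C y \<in> M"
      using csubspaceD [OF M(1)] m(1) y by blast
    then have "norm r \<le> norm (r - t *\<^sub>C y)"
      using m(2) by (simp add: r_def diff_diff_eq)
    then have "(norm r)\<^sup>2 \<le> (norm (r - t *\<^sub>C y))\<^sup>2"
      by (simp add: power_mono)
    then have "(cmod (cinner r y))\<^sup>2 / (norm y)\<^sup>2 \<le> 0"
      using norm_projection_residual [OF False, of r] by (simp add: t_def)
    then have "cinner r y = 0"
      using False by (simp add: divide_le_0_iff)
    then show ?thesis
      using cinner_commute [of y r] by simp
  qed simp
  then show ?thesis
    using m(1) by (auto simp: r_def)
qed

lemma csubspace_closure:
  fixes M :: "'a::complex_normed_vector set"
  assumes M: "csubspace M"
  shows "csubspace (closure M)"
  unfolding complex_vector.subspace_def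
proof (intro conjI ballI allI)
  show "0 \<in> closure M"
    using csubspaceD(1) [OF M] closure_subset by blast
next
  fix x y assume "x \<in> closure M" "y \<in> closure M"
  then obtain s t where "\<And>n. s n \<in> M" "s \<longlonglongrightarrow> x" "\<And>n. t n \<in> M" "t \<longlonglongrightarrow> y"
    unfolding closure_sequential by blast
  then have "\<forall>n. s n + t n \<in> M" "(\<lambda>n. s n + t n) \<longlonglongrightarrow> x + y"
    using csubspaceD(2) [OF M] by (auto intro: tendsto_intros)
  then show "x + y \<in> closure M"
    unfolding closure_sequential by (intro exI [of _ "\<lambda>n. s n + t n"]) simp
next
  fix a :: complex and x assume "x \<in> closure M"
  then obtain s where s: "\<And>n. s n \<in> M" "s \<longlonglongrightarrow> x"
    unfolding closure_sequential by blast
  have "(\<lambda>n. cmod a * norm (s n - x)) \<longlonglongrightarrow> cmod a * 0"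
    using s(2) by (intro tendsto_mult tendsto_const) (simp add: LIM_zero tendsto_norm_zero)
  then have "(\<lambda>n. norm (a *\<^sub>C s n - a *\<^sub>C x)) \<longlonglongrightarrow> 0"
    by (simp add: norm_scaleC flip: complex_vector.scale_right_diff_distrib)
  then have "(\<lambda>n. a *\<^sub>C s n) \<longlonglongrightarrow> a *\<^sub>C x"
    by (rule LIM_zero_cancel [OF tendsto_norm_zero_cancel])
  then show "a *\<^sub>C x \<in> closure M"
    unfolding closure_sequential using csubspaceD(4) [OF M] s(1)
    by (intro exI [of _ "\<lambda>n. a *\<^sub>C s n"]) simp
qed

lemma orthogonal_closure:
  fixes x y :: "'a::complex_inner"
  assumes "\<And>m. m \<in> M \<Longrightarrow> cinner m y = 0" and "x \<in> closure M"
  shows "cinner x y = 0"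
proof -
  have "closed {x. cinner x y = 0}"
    by (intro closed_Collect_eq continuous_intros)
  then have "closure M \<subseteq> {x. cinner x y = 0}"
    using assms(1) by (intro closure_minimal) auto
  then show ?thesis
    using assms(2) by blast
qed

lemma orthogonal_dense:
  fixes y :: "'a::complex_inner"
  assumes "\<And>m. m \<in> M \<Longrightarrow> cinner m y = 0" and "closure M = UNIV"
  shows "y = 0"
  using orthogonal_closure [of M y y] assms by simp

text \<open>The residual of the projection of \<open>x\<close> onto \<open>closure M\<close> is orthogonal to \<open>M\<close>, hence to \<open>x\<close> and
  therefore to itself.\<close>

lemma in_closure_if_biorthogonal:
  fixes x :: "'a::chilbert_space"
  assumes M: "csubspace M" and x: "\<And>y. (\<And>m. m \<in> M \<Longrightarrow> cinner m y = 0) \<Longrightarrow> cinner x y = 0"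
  shows "x \<in> closure M"
proof -
  obtain p where p: "p \<in> closure M" "\<And>y. y \<in> closure M \<Longrightarrow> cinner y (x - p) = 0"
    using orthogonal_projection_exists [OF csubspace_closure [OF M] closed_closure] by blast
  have "cinner x (x - p) = 0"
    using p(2) closure_subset by (intro x) blast
  then have "cinner (x - p) (x - p) = 0"
    using p by (simp add: cinner_diff_left)
  then show ?thesis
    using p(1) by simp
qed


section \<open>Adjoints and resolvents\<close>

lemma adjoint_op_iff:
  "(g, g') \<in> adjoint_op S \<longleftrightarrow> (\<forall>(f, f')\<in>S. cinner f' g = cinner f g')"
  by (simp add: adjoint_op_def)

lemma adjoint_opD: "(g, g') \<in> adjoint_op S \<Longrightarrow> (f, f') \<in> S \<Longrightarrow> cinner f' g = cinner f g'"
  by (auto simp: adjoint_op_iff)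

lemma adjoint_opD': "(g, g') \<in> adjoint_op S \<Longrightarrow> (f, f') \<in> S \<Longrightarrow> cinner g f' = cinner g' f"
  by (metis adjoint_opD cinner_commute)

text \<open>The adjoint is a rotated orthogonal complement of the graph.\<close>

lemma adjoint_op_iff_orthogonal:
  "(g, g') \<in> adjoint_op S \<longleftrightarrow> (\<forall>p\<in>S. cinner p (g', - g) = 0)"
  by (auto simp: adjoint_op_iff cinner_prod_def cinner_minus_right)

lemma csubspace_adjoint_op: "csubspace (adjoint_op S)"
  by (fastforce simp: complex_vector.subspace_def adjoint_op_iff cinner_simps zero_prod_def)

text \<open>Two images of the same vector under the adjoint differ by a vector orthogonal to the domain.\<close>

lemma linear_operator_adjoint_op:
  assumes "densely_defined S"
  shows "linear_operator (adjoint_op S)"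
proof -
  have "x = y" if "(f, x) \<in> adjoint_op S" "(f, y) \<in> adjoint_op S" for f x y
  proof -
    have "cinner u (x - y) = 0" if "u \<in> Domain S" for u
      using that adjoint_opD [OF \<open>(f, x) \<in> adjoint_op S\<close>] adjoint_opD [OF \<open>(f, y) \<in> adjoint_op S\<close>]
      by (metis DomainE cinner_diff_right eq_iff_diff_eq_0)
    then have "x - y = 0"
      using assms orthogonal_dense unfolding densely_defined_def by blast
    then show ?thesis
      by simp
  qed
  then show ?thesis
    by (simp add: linear_operator_def single_valued_def csubspace_adjoint_op)
qed

lemma adjoint_op_closure [simp]: "adjoint_op (closure S) = adjoint_op S"
proof -
  have "(g, g') \<in> adjoint_op (closure S) \<longleftrightarrow> (g, g') \<in> adjoint_op S" for g g' :: 'a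
    unfolding adjoint_op_iff_orthogonal
    using orthogonal_closure [of S "(g', - g)"] closure_subset [of S] by blast
  then show ?thesis
    by (simp add: set_eq_iff split_paired_all)
qed

lemma closed_adjoint_op: "closed (adjoint_op S)"
proof -
  have "adjoint_op S = (\<Inter>q\<in>S. {p. cinner (snd q) (fst p) = cinner (fst q) (snd p)})"
    by (force simp: adjoint_op_def)
  then show ?thesis
    by (auto intro!: closed_INT closed_Collect_eq continuous_intros)
qed

text \<open>Rotating twice is multiplication by \<open>-1\<close>, so the second adjoint is the double orthogonal
  complement of the graph.\<close>

lemma adjoint_op_adjoint_op_subset:
  fixes S :: "'h::chilbert_space oper"
  assumes "csubspace S"
  shows "adjoint_op (adjoint_op S) \<subseteq> closure S"
proof
  fix p assume p: "p \<in> adjoint_op (adjoint_op S)"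
  obtain g g' where [simp]: "p = (g, g')"
    by (cases p)
  show "p \<in> closure S"
  proof (rule in_closure_if_biorthogonal [OF assms])
    fix q assume q: "\<And>m. m \<in> S \<Longrightarrow> cinner m q = 0"
    obtain a b where [simp]: "q = (a, b)"
      by (cases q)
    have "(- b, a) \<in> adjoint_op S"
      using q by (simp add: adjoint_op_iff_orthogonal)
    from adjoint_opD' [OF _ this] p show "cinner p q = 0"
      by (auto simp: cinner_minus_right)
  qed
qed

lemma in_eigenspace_iff: "f \<in> eigenspace S z \<longleftrightarrow> (f, z *\<^sub>C f) \<in> S"
  by (auto simp: eigenspace_def shift_op_def)

lemma csubspace_eigenspace:
  assumes "csubspace S"
  shows "csubspace (eigenspace S z)"
proof -
  note S = csubspaceD [OF assms]
  show ?thesis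
    unfolding complex_vector.subspace_def
  proof (intro conjI ballI allI, unfold in_eigenspace_iff)
    show "(0, z *\<^sub>C 0) \<in> S"
      using S(1) by (simp add: zero_prod_def)
    show "(x + y, z *\<^sub>C (x + y)) \<in> S" if "(x, z *\<^sub>C x) \<in> S" "(y, z *\<^sub>C y) \<in> S" for x y
      using S(2) [OF that] by (simp add: scaleC_add_right)
    show "(a *\<^sub>C x, z *\<^sub>C a *\<^sub>C x) \<in> S" if "(x, z *\<^sub>C x) \<in> S" for a x
      using S(4) [OF that, of a] by (simp add: scaleC_scaleC mult.commute)
  qed
qed

lemma resolvent_set_surj:
  assumes "z \<in> resolvent_set B"
  obtains f f' where "(f, f') \<in> B" "h = f' - z *\<^sub>C f"
  using assms unfolding resolvent_set_def shift_op_def by blast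

lemma resolvent_set_inj:
  assumes "z \<in> resolvent_set B" "(f, z *\<^sub>C f) \<in> B" "csubspace B"
  shows "f = 0"
proof -
  have "(f, 0) \<in> shift_op B z" "(0, 0) \<in> shift_op B z"
    using assms(2) csubspaceD(1) [OF assms(3)] by (force simp: shift_op_def zero_prod_def)+
  then show ?thesis
    using assms(1) unfolding resolvent_set_def by blast
qed

text \<open>If \<open>z\<close> is in the resolvent set of \<open>B\<close>, then \<open>dom S = dom B + ker (S - z)\<close> for each
  extension \<open>S\<close> of \<open>B\<close>: given \<open>f\<close>, solve \<open>(B - z) u = (S - z) f\<close>.\<close>

lemma resolvent_decomposition:
  assumes "z \<in> resolvent_set B" "B \<subseteq> S" "csubspace S" "(f, f') \<in> S"
  obtains u u' where "(u, u') \<in> B" "f - u \<in> eigenspace S z" "f' = u' + z *\<^sub>C (f - u)"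
proof -
  obtain u u' where u: "(u, u') \<in> B" "f' - z *\<^sub>C f = u' - z *\<^sub>C u"
    using resolvent_set_surj [OF assms(1)] by blast
  then have f': "f' = u' + z *\<^sub>C (f - u)"
    by (simp add: complex_vector.scale_right_diff_distrib algebra_simps)
  have "(f, f') - (u, u') \<in> S"
    using u(1) assms by (intro csubspaceD(3)) auto
  then have "f - u \<in> eigenspace S z"
    by (simp add: in_eigenspace_iff f')
  then show thesis
    using that u(1) f' by blast
qed

text \<open>The difference of two candidates lies in \<open>dom B\<close> and in \<open>ker (S - z)\<close>, hence in \<open>ker (B - z)\<close>.\<close>

lemma first_component_eq:
  assumes "z \<in> resolvent_set B" "B \<subseteq> S" "csubspace B" "linear_operator S"
    and "u \<in> Domain B" "f - u \<in> eigenspace S z"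
  shows "first_component (Domain B) (eigenspace S z) f = u"
  unfolding first_component_def
proof (rule the_equality)
  fix v assume v: "v \<in> Domain B \<and> f - v \<in> eigenspace S z"
  have S: "csubspace S" "single_valued S"
    using assms(4) by (auto simp: linear_operator_def)
  obtain u' v' where uv: "(u, u') \<in> B" "(v, v') \<in> B"
    using v assms(5) by blast
  then have B: "(v - u, v' - u') \<in> B"
    using csubspaceD(3) [OF assms(3), of "(v, v')" "(u, u')"] by simp
  have "(v - u, z *\<^sub>C (v - u)) \<in> S"
    using csubspaceD(3) [OF S(1), of "(f - u, z *\<^sub>C (f - u))" "(f - v, z *\<^sub>C (f - v))"] v assms(6)
    by (simp add: in_eigenspace_iff flip: complex_vector.scale_right_diff_distrib)
  then have "(v - u, z *\<^sub>C (v - u)) \<in> B"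
    using B assms(2) S(2) by (metis single_valuedD subsetD)
  then show "v = u"
    using resolvent_set_inj [OF assms(1) _ assms(3)] by fastforce
qed (use assms in auto)


section \<open>Evaluation of functionals in the anti-dual\<close>

lemma antidualD:
  assumes "\<phi> \<in> antidual X n" "x \<in> X"
  shows "y \<in> X \<Longrightarrow> \<phi> (x + y) = \<phi> x + \<phi> y" "\<phi> (a *\<^sub>C x) = cnj a * \<phi> x"
  using assms by (auto simp: antidual_def antilinear_on_def scaleC_complex_def)

lemma antidual_diff:
  assumes X: "norm_on X n" and "\<phi> \<in> antidual X n" "\<psi> \<in> antidual X n"
  shows "\<phi> - \<psi> \<in> antidual X n"
proof -
  have "\<exists>d>0. \<forall>y\<in>X. n (y - x) < d \<longrightarrow> cmod ((\<phi> - \<psi>) y - (\<phi> - \<psi>) x) < e"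
    if "x \<in> X" "0 < e" for x e
  proof -
    have "\<exists>d>0. \<forall>y\<in>X. n (y - x) < d \<longrightarrow> cmod (\<phi> y - \<phi> x) < e/2"
      "\<exists>d>0. \<forall>y\<in>X. n (y - x) < d \<longrightarrow> cmod (\<psi> y - \<psi> x) < e/2"
      using assms(2,3) that half_gt_zero [OF that(2)]
      unfolding antidual_def continuous_between_def by blast+
    then obtain d d' where d: "d > 0" "d' > 0"
      "\<And>y. y \<in> X \<Longrightarrow> n (y - x) < d \<Longrightarrow> cmod (\<phi> y - \<phi> x) < e/2"
      "\<And>y. y \<in> X \<Longrightarrow> n (y - x) < d' \<Longrightarrow> cmod (\<psi> y - \<psi> x) < e/2"
      by blast
    have "cmod ((\<phi> - \<psi>) y - (\<phi> - \<psi>) x) < e" if "y \<in> X" "n (y - x) < min d d'" for y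
    proof -
      have "cmod ((\<phi> y - \<phi> x) - (\<psi> y - \<psi> x)) < e/2 + e/2"
        using norm_triangle_ineq4 [of "\<phi> y - \<phi> x" "\<psi> y - \<psi> x"] d(3,4) [OF that(1)] that(2)
        by linarith
      then show ?thesis
        by (simp add: algebra_simps del: less_divide_eq_numeral1)
    qed
    then show ?thesis
      using d(1,2) by (meson min_less_iff_conj)
  qed
  moreover have "antilinear_on X (\<phi> - \<psi>)"
    using assms(2,3) by (auto simp: antilinear_on_def antidualD scaleC_complex_def algebra_simps)
  ultimately show ?thesis
    using assms(2,3) by (auto simp: antidual_def continuous_between_def)
qed

text \<open>Continuity at \<open>0\<close> bounds an antilinear functional on the unit ball, so that the supremum
  defining its norm is not a default value.\<close>

lemma antidual_norm_bound:
  assumes X: "norm_on X n" and \<phi>: "\<phi> \<in> antidual X n" and x: "x \<in> X"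
  shows "cmod (\<phi> x) \<le> (n x + 1) * antidual_norm X n \<phi>"
proof -
  have sub: "csubspace X" and nn: "\<And>a x. x \<in> X \<Longrightarrow> n (a *\<^sub>C x) = cmod a * n x"
    and pos: "\<And>x. x \<in> X \<Longrightarrow> 0 \<le> n x"
    using X by (auto simp: norm_on_def)
  have \<phi>0: "\<phi> 0 = 0"
    using antidualD(2) [OF \<phi> csubspaceD(1) [OF sub], of 0] by simp
  have "\<exists>d>0. \<forall>y\<in>X. n (y - 0) < d \<longrightarrow> cmod (\<phi> y - \<phi> 0) < 1"
    using \<phi> csubspaceD(1) [OF sub] by (auto simp: antidual_def continuous_between_def)
  then obtain d where d: "d > 0" "\<And>y. y \<in> X \<Longrightarrow> n y < d \<Longrightarrow> cmod (\<phi> y) < 1"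
    by (auto simp: \<phi>0)
  have ball: "cmod (\<phi> y) \<le> 2 / d" if "y \<in> X" "n y \<le> 1" for y
  proof -
    have "n (complex_of_real (d/2) *\<^sub>C y) < d"
    proof -
      have "n (complex_of_real (d/2) *\<^sub>C y) = d * n y / 2"
        using d(1) nn [OF that(1), of "complex_of_real (d/2)"] by simp
      moreover have "d * n y \<le> d"
        using that(2) d(1) by simp
      ultimately show ?thesis
        using d(1) by linarith
    qed
    then have "cmod (\<phi> (complex_of_real (d/2) *\<^sub>C y)) < 1"
      using that csubspaceD(4) [OF sub] d(2) by blast
    then show ?thesis
      using d(1) antidualD(2) [OF \<phi> that(1)] by (simp add: norm_mult field_simps)
  qed
  (* Dividing by n x + 1 rather than n x covers x = 0 as well. *)
  define c where "c = 1 / (n x + 1)"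
  have c: "c > 0" "c * n x \<le> 1"
    using pos [OF x] by (simp_all add: c_def)
  have "complex_of_real c *\<^sub>C x \<in> X" "n (complex_of_real c *\<^sub>C x) \<le> 1"
    using x csubspaceD(4) [OF sub] c nn [OF x, of "complex_of_real c"] by simp_all
  then have "cmod (\<phi> (complex_of_real c *\<^sub>C x)) \<le> antidual_norm X n \<phi>"
    unfolding antidual_norm_def
    using ball by (intro cSUP_upper bdd_aboveI2) auto
  moreover have "cmod (\<phi> (complex_of_real c *\<^sub>C x)) = cmod (\<phi> x) / (n x + 1)"
    using antidualD(2) [OF \<phi> x] c(1) by (simp add: norm_mult) (simp add: c_def)
  ultimately show ?thesis
    using pos [OF x] by (simp add: pos_divide_le_eq mult.commute)
qed


section \<open>Boundary triples\<close>

lemma op_apply_eq: "single_valued S \<Longrightarrow> (f, f') \<in> S \<Longrightarrow> op_apply S f = f'"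
  unfolding op_apply_def by (rule the_equality) (auto dest: single_valuedD)

lemma clinear_onD:
  assumes "clinear_on X f" "x \<in> X"
  shows "y \<in> X \<Longrightarrow> f (x + y) = f x + f y" "f (a *\<^sub>C x) = a *\<^sub>C f x"
  using assms by (auto simp: clinear_on_def)

lemma clinear_on_zero: "clinear_on X f \<Longrightarrow> 0 \<in> X \<Longrightarrow> f 0 = 0"
  using clinear_onD(1) [of X f 0 0] by simp

lemma csubspace_image:
  assumes "csubspace X" "clinear_on X f"
  shows "csubspace (f ` X)"
  unfolding complex_vector.subspace_def
proof (intro conjI ballI allI)
  note X = csubspaceD [OF assms(1)] and f = clinear_onD [OF assms(2)]
  show "0 \<in> f ` X"
    using X(1) clinear_on_zero [OF assms(2)] by (metis imageI)
  show "p + q \<in> f ` X" if "p \<in> f ` X" "q \<in> f ` X" for p q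
    using that X(2) f(1) by (metis (no_types, lifting) image_iff)
  show "a *\<^sub>C p \<in> f ` X" if "p \<in> f ` X" for a p
    using that X(4) f(2) by (metis (no_types, lifting) image_iff)
qed

lemma csubspace_Domain:
  assumes "csubspace S"
  shows "csubspace (Domain S)"
  using csubspace_image [OF assms, of fst]
  by (simp add: clinear_on_def scaleC_prod_def flip: fst_eq_Domain)

lemma quasi_boundary_tripleD:
  assumes "quasi_boundary_triple A T \<Gamma>\<^sub>0 \<Gamma>\<^sub>1"
  shows "linear_operator T" "T \<subseteq> adjoint_op A" "closure T = adjoint_op A"
    "clinear_on (Domain T) \<Gamma>\<^sub>0" "clinear_on (Domain T) \<Gamma>\<^sub>1"
    "closure ((\<lambda>f. (\<Gamma>\<^sub>0 f, \<Gamma>\<^sub>1 f)) ` Domain T) = UNIV" "selfadjoint_op (restrict_ker T \<Gamma>\<^sub>0)"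
    "(f, f') \<in> T \<Longrightarrow> (g, g') \<in> T \<Longrightarrow>
      cinner f' g - cinner f g' = cinner (\<Gamma>\<^sub>1 f) (\<Gamma>\<^sub>0 g) - cinner (\<Gamma>\<^sub>0 f) (\<Gamma>\<^sub>1 g)"
  using assms unfolding quasi_boundary_triple_def by blast+

lemma restrict_ker_iff: "(f, f') \<in> restrict_ker S \<Gamma> \<longleftrightarrow> (f, f') \<in> S \<and> \<Gamma> f = 0"
  by (simp add: restrict_ker_def)

text \<open>Only the density of the joint range is required of the two boundary maps, but it implies
  that the range of the first one is dense.\<close>

lemma orthogonal_ran_boundary_map:
  assumes "quasi_boundary_triple A T \<Gamma>\<^sub>0 \<Gamma>\<^sub>1" and "\<And>f. f \<in> Domain T \<Longrightarrow> cinner (\<Gamma>\<^sub>0 f) y = 0"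
  shows "y = 0"
proof -
  have "(y, 0 :: 'b) = 0"
    by (rule orthogonal_dense [OF _ quasi_boundary_tripleD(6) [OF assms(1)]]) (use assms(2) in fastforce)
  then show ?thesis
    by (simp add: zero_prod_def)
qed

text \<open>
  An element of \<open>A\<close> lies in \<open>A\<^sub>0\<^sup>* = A\<^sub>0\<close>, and the abstract Green identity makes its \<open>\<Gamma>\<^sub>1\<close>-value
  orthogonal to the dense range of \<open>\<Gamma>\<^sub>0\<close>. Conversely, vanishing boundary values make all boundary
  terms vanish, which places an element of \<open>T\<close> in \<open>T\<^sup>* = A\<^sup>*\<^sup>*\<close>.
\<close>

lemma minimal_operator_eq:
  assumes q: "quasi_boundary_triple A T \<Gamma>\<^sub>0 \<Gamma>\<^sub>1" and A: "csubspace A" "closed A"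
  shows "A = restrict_ker (restrict_ker T \<Gamma>\<^sub>0) \<Gamma>\<^sub>1"
proof (rule set_eqI, unfold split_paired_all, rule iffI)
  note qD = quasi_boundary_tripleD [OF q]
  fix f f' assume f: "(f, f') \<in> A"
  have "(f, f') \<in> adjoint_op (restrict_ker T \<Gamma>\<^sub>0)"
    using qD(2) adjoint_opD' [OF _ f] by (auto simp: adjoint_op_iff restrict_ker_iff dest!: subsetD)
  then have f0: "(f, f') \<in> T" "\<Gamma>\<^sub>0 f = 0"
    using qD(7) by (auto simp: selfadjoint_op_def restrict_ker_iff)
  have "cinner (\<Gamma>\<^sub>0 g) (\<Gamma>\<^sub>1 f) = 0" if "g \<in> Domain T" for g
  proof -
    obtain g' where g: "(g, g') \<in> T"
      using \<open>g \<in> Domain T\<close> by blast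
    have "(g, g') \<in> adjoint_op A"
      using g qD(2) by blast
    from qD(8) [OF g f0(1)] adjoint_opD' [OF this f] show ?thesis
      by (simp add: f0(2))
  qed
  then have "\<Gamma>\<^sub>1 f = 0"
    using orthogonal_ran_boundary_map [OF q] by blast
  then show "(f, f') \<in> restrict_ker (restrict_ker T \<Gamma>\<^sub>0) \<Gamma>\<^sub>1"
    using f0 by (simp add: restrict_ker_iff)
next
  note qD = quasi_boundary_tripleD [OF q]
  fix f f' assume "(f, f') \<in> restrict_ker (restrict_ker T \<Gamma>\<^sub>0) \<Gamma>\<^sub>1"
  then have f: "(f, f') \<in> T" "\<Gamma>\<^sub>0 f = 0" "\<Gamma>\<^sub>1 f = 0"
    by (auto simp: restrict_ker_iff)
  have "(f, f') \<in> adjoint_op T"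
    using qD(8) [OF _ f(1)] f(2,3) by (auto simp: adjoint_op_iff)
  then have "(f, f') \<in> adjoint_op (adjoint_op A)"
    using adjoint_op_closure [of T] qD(3) by simp
  then show "(f, f') \<in> A"
    using adjoint_op_adjoint_op_subset [OF A(1)] A(2) by auto
qed

text \<open>
  On \<open>T\<close> the formula is the abstract Green identity with \<open>\<Gamma>\<^sub>0 u = 0\<close>. Both sides are continuous in
  the graph norm, and \<open>T\<close> is dense in \<open>A\<^sup>*\<close>.
\<close>

lemma extended_boundary_map_formula:
  assumes q: "quasi_boundary_triple A T \<Gamma>\<^sub>0 \<Gamma>\<^sub>1" and A: "densely_defined A"
    and G: "norm_on G n" "\<Gamma>\<^sub>1 ` {f \<in> Domain T. \<Gamma>\<^sub>0 f = 0} \<subseteq> G"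
    and ext: "continuous_extension A T \<Gamma>\<^sub>0 G n \<Gamma>'"
    and f: "(f, f') \<in> adjoint_op A" and u: "(u, u') \<in> restrict_ker T \<Gamma>\<^sub>0"
  shows "\<Gamma>' f (\<Gamma>\<^sub>1 u) = cinner f u' - cinner f' u"
proof -
  note qD = quasi_boundary_tripleD [OF q]
  let ?S = "adjoint_op A" and ?x = "\<Gamma>\<^sub>1 u"
  have uT: "(u, u') \<in> T" "\<Gamma>\<^sub>0 u = 0" and x: "?x \<in> G"
    using u G(2) by (auto simp: restrict_ker_iff)
  have S: "csubspace ?S" "single_valued ?S"
    using linear_operator_adjoint_op [OF A] by (auto simp: linear_operator_def)
  have cont: "\<Gamma>' ` Domain ?S \<subseteq> antidual G n"
    "\<And>e. e > 0 \<Longrightarrow> \<exists>d>0. \<forall>y\<in>Domain ?S. graph_norm ?S (y - f) < d \<longrightarrow>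
      antidual_norm G n (\<Gamma>' y - \<Gamma>' f) < e"
    using ext f unfolding continuous_extension_def continuous_between_def by blast+
  obtain s where s: "\<And>k. s k \<in> T" "s \<longlonglongrightarrow> (f, f')"
    using f qD(3) unfolding closure_sequential [symmetric] by (metis closure_sequential)
  define g where "g k = fst (s k)" for k
  define g' where "g' k = snd (s k)" for k
  have g: "\<And>k. (g k, g' k) \<in> T" "g \<longlonglongrightarrow> f" "g' \<longlonglongrightarrow> f'"
    using s tendsto_fst [OF s(2)] tendsto_snd [OF s(2)] by (simp_all add: g_def [abs_def] g'_def [abs_def])
  have gS: "(g k, g' k) \<in> ?S" for k
    using g(1) qD(2) by blast
  have val: "\<Gamma>' (g k) ?x = cinner (g k) u' - cinner (g' k) u" for k
  proof -
    have "\<Gamma>' (g k) = antidual_embed G (\<Gamma>\<^sub>0 (g k))"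
      using ext g(1) unfolding continuous_extension_def by blast
    then show ?thesis
      using qD(8) [OF g(1) uT(1), of k] x uT(2) by (simp add: antidual_embed_def algebra_simps)
  qed
  have "(\<lambda>k. \<Gamma>' (g k) ?x) \<longlonglongrightarrow> \<Gamma>' f ?x"
  proof (rule tendstoI)
    fix e :: real assume e: "e > 0"
    have p: "n ?x + 1 > 0"
      using G(1) x by (auto simp: norm_on_def add_nonneg_pos)
    obtain d where d: "d > 0" "\<And>y. y \<in> Domain ?S \<Longrightarrow> graph_norm ?S (y - f) < d \<Longrightarrow>
        antidual_norm G n (\<Gamma>' y - \<Gamma>' f) < e / (n ?x + 1)"
      using cont(2) [of "e / (n ?x + 1)"] e p by auto
    have gn: "graph_norm ?S (g k - f) = norm (s k - (f, f'))" for k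
    proof -
      have "(g k - f, g' k - f') \<in> ?S"
        using csubspaceD(3) [OF S(1) gS f] by simp
      then show ?thesis
        using op_apply_eq [OF S(2)] by (simp add: graph_norm_def g_def g'_def minus_prod_def)
    qed
    have "\<forall>\<^sub>F k in sequentially. dist (s k) (f, f') < d"
      using s(2) d(1) by (rule tendstoD)
    then show "\<forall>\<^sub>F k in sequentially. dist (\<Gamma>' (g k) ?x) (\<Gamma>' f ?x) < e"
    proof (rule eventually_mono)
      fix k assume "dist (s k) (f, f') < d"
      then have "antidual_norm G n (\<Gamma>' (g k) - \<Gamma>' f) < e / (n ?x + 1)"
        using d(2) [of "g k"] gS [of k] gn [of k] by (auto simp: dist_norm)
      then have "(n ?x + 1) * antidual_norm G n (\<Gamma>' (g k) - \<Gamma>' f) < e"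
        using p by (simp add: pos_less_divide_eq mult.commute)
      moreover have "\<Gamma>' (g k) - \<Gamma>' f \<in> antidual G n"
        using cont(1) gS f by (intro antidual_diff G(1)) blast+
      ultimately show "dist (\<Gamma>' (g k) ?x) (\<Gamma>' f ?x) < e"
        using antidual_norm_bound [OF G(1) _ x] by (fastforce simp: dist_norm)
    qed
  qed
  moreover have "(\<lambda>k. \<Gamma>' (g k) ?x) \<longlonglongrightarrow> cinner f u' - cinner f' u"
    unfolding val using g by (intro tendsto_intros)
  ultimately show ?thesis
    by (rule LIMSEQ_unique)
qed

text \<open>
  The components in \<open>ker (A\<^sup>* - \<eta>)\<close> contribute nothing among themselves because \<open>\<eta>\<close> is real, nor do
  the components in \<open>dom A\<^sub>0\<close> because \<open>A\<^sub>0\<close> is symmetric; only the mixed terms remain.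
\<close>

lemma green_identity_decomposed:
  fixes \<eta> :: real
  assumes "cinner u' v = cinner u v'"
    and "f' = u' + complex_of_real \<eta> *\<^sub>C (f - u)" "g' = v' + complex_of_real \<eta> *\<^sub>C (g - v)"
  shows "cinner f' g - cinner f g'
    = cnj (cinner g u' - cinner g' u) - (cinner f v' - cinner f' v)"
proof -
  have "cnj (cinner g u' - cinner g' u) = cinner u' g - cinner u g'"
    by (simp flip: cinner_commute)
  then show ?thesis
    using assms(1) unfolding assms(2,3) by (simp add: cinner_simps algebra_simps)
qed

theorem theorem2p12:
  fixes A T A\<^sub>0 :: "'h::chilbert_space oper"
    and \<Gamma>\<^sub>0 \<Gamma>\<^sub>1 \<Upsilon>\<^sub>0 \<Upsilon>\<^sub>1 :: "'h \<Rightarrow> 'g::chilbert_space"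
    and G\<^sub>1 :: "'g set"
    and n\<^sub>1 :: "'g \<Rightarrow> real"
    and \<Gamma>\<^sub>0' :: "'h \<Rightarrow> 'g \<Rightarrow> complex"
    and \<iota>p :: "'g \<Rightarrow> 'g"
    and \<iota>m :: "('g \<Rightarrow> complex) \<Rightarrow> 'g"
    and \<eta> :: real
  assumes "separable_space (euclidean :: 'h topology)"
    and "linear_operator A" and "closed A" and "densely_defined A" and "symmetric_op A"
    and "quasi_boundary_triple A T \<Gamma>\<^sub>0 \<Gamma>\<^sub>1"
    and "A\<^sub>0 = restrict_ker T \<Gamma>\<^sub>0"
    and "complex_of_real \<eta> \<in> resolvent_set A\<^sub>0"
    and "G\<^sub>1 = \<Gamma>\<^sub>1 ` {f \<in> Domain T. \<Gamma>\<^sub>0 f = 0}"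
    and "closure G\<^sub>1 = UNIV"
    and "admissible_norm A\<^sub>0 \<Gamma>\<^sub>1 G\<^sub>1 n\<^sub>1"
    and "continuous_extension A T \<Gamma>\<^sub>0 G\<^sub>1 n\<^sub>1 \<Gamma>\<^sub>0'"
    and "isometric_isomorphism G\<^sub>1 n\<^sub>1 UNIV norm \<iota>p"
    and "isometric_isomorphism (antidual G\<^sub>1 n\<^sub>1) (antidual_norm G\<^sub>1 n\<^sub>1) UNIV norm \<iota>m"
    and "\<forall>x\<in>G\<^sub>1. \<forall>\<phi>\<in>antidual G\<^sub>1 n\<^sub>1. cinner (\<iota>m \<phi>) (\<iota>p x) = \<phi> x"
    and "\<Upsilon>\<^sub>0 = (\<lambda>f. \<iota>m (\<Gamma>\<^sub>0' f))"
    and "\<Upsilon>\<^sub>1 = (\<lambda>f. \<iota>p (\<Gamma>\<^sub>1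
           (first_component (Domain A\<^sub>0) (eigenspace (adjoint_op A) (complex_of_real \<eta>)) f)))"
  shows "ordinary_boundary_triple A \<Upsilon>\<^sub>0 \<Upsilon>\<^sub>1 \<and>
    restrict_ker (adjoint_op A) \<Upsilon>\<^sub>0 = A\<^sub>0 \<and>
    is_direct_sum (restrict_ker (adjoint_op A) \<Upsilon>\<^sub>1)
      A (eigenspace_graph (adjoint_op A) (complex_of_real \<eta>))"
proof -
  let ?S = "adjoint_op A" and ?\<eta> = "complex_of_real \<eta>"
  note q = \<open>quasi_boundary_triple A T \<Gamma>\<^sub>0 \<Gamma>\<^sub>1\<close>
  note qD = quasi_boundary_tripleD [OF q]
  have S: "linear_operator ?S"
    using linear_operator_adjoint_op assms by blast
  then have Ssub: "csubspace ?S" and Ssv: "single_valued ?S"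
    by (auto simp: linear_operator_def)
  have A: "csubspace A" "closed A"
    using assms by (auto simp: linear_operator_def)
  have A0: "A\<^sub>0 \<subseteq> ?S" "csubspace A\<^sub>0" "adjoint_op A\<^sub>0 = A\<^sub>0" "selfadjoint_op A\<^sub>0"
    using qD(2,7) by (auto simp: \<open>A\<^sub>0 = _\<close> restrict_ker_iff selfadjoint_op_def linear_operator_def)
  have A_eq: "A = restrict_ker A\<^sub>0 \<Gamma>\<^sub>1"
    using minimal_operator_eq [OF q A] by (simp add: \<open>A\<^sub>0 = _\<close>)
  have G1: "\<Gamma>\<^sub>1 u \<in> G\<^sub>1" if "(u, u') \<in> A\<^sub>0" for u u'
    using that by (auto simp: \<open>A\<^sub>0 = _\<close> \<open>G\<^sub>1 = _\<close> restrict_ker_iff)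
  have G1_cases: "\<exists>u u'. (u, u') \<in> A\<^sub>0 \<and> x = \<Gamma>\<^sub>1 u" if "x \<in> G\<^sub>1" for x
    using that by (auto simp: \<open>A\<^sub>0 = _\<close> \<open>G\<^sub>1 = _\<close> restrict_ker_iff)
  have norm1: "norm_on G\<^sub>1 n\<^sub>1"
    using assms by (simp add: admissible_norm_def banach_on_def)
  then have G1sub: "csubspace G\<^sub>1"
    by (simp add: norm_on_def)
  have \<iota>p: "clinear_on G\<^sub>1 \<iota>p" "inj_on \<iota>p G\<^sub>1" "\<iota>p ` G\<^sub>1 = UNIV"
    using assms by (auto simp: isometric_isomorphism_def bij_betw_def)
  have \<Gamma>0'_mem: "\<Gamma>\<^sub>0' f \<in> antidual G\<^sub>1 n\<^sub>1" if "(f, f') \<in> ?S" for f f'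
    using assms that unfolding continuous_extension_def continuous_between_def by blast
  have formula: "\<Gamma>\<^sub>0' f (\<Gamma>\<^sub>1 u) = cinner f u' - cinner f' u"
    if "(f, f') \<in> ?S" "(u, u') \<in> A\<^sub>0" for f f' u u'
    using extended_boundary_map_formula [OF q _ norm1] assms that by blast
  have \<Upsilon>0: "cinner (\<Upsilon>\<^sub>0 f) (\<iota>p (\<Gamma>\<^sub>1 u)) = cinner f u' - cinner f' u"
    if "(f, f') \<in> ?S" "(u, u') \<in> A\<^sub>0" for f f' u u'
    using assms(15) \<Gamma>0'_mem [OF that(1)] G1 [OF that(2)] formula [OF that] by (simp add: \<open>\<Upsilon>\<^sub>0 = _\<close>)
  (* The vectors \<iota>p (\<Gamma>\<^sub>1 u) exhaust the boundary space, so the formula determines \<Upsilon>\<^sub>0 f. *)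
  have \<Upsilon>0_eqI: "\<Upsilon>\<^sub>0 f = y"
    if "(f, f') \<in> ?S" "\<And>u u'. (u, u') \<in> A\<^sub>0 \<Longrightarrow> cinner y (\<iota>p (\<Gamma>\<^sub>1 u)) = cinner f u' - cinner f' u"
    for f f' y
  proof -
    obtain x where x: "x \<in> G\<^sub>1" "\<Upsilon>\<^sub>0 f - y = \<iota>p x"
      using \<iota>p(3) by (metis UNIV_I imageE)
    obtain u u' where "(u, u') \<in> A\<^sub>0" "x = \<Gamma>\<^sub>1 u"
      using G1_cases [OF x(1)] by blast
    then have "cinner (\<Upsilon>\<^sub>0 f - y) (\<Upsilon>\<^sub>0 f - y) = 0"
      using that(2) \<Upsilon>0 [OF that(1)] x(2) by (metis cinner_diff_left diff_self)
    then show ?thesis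
      by simp
  qed
  have decomp: "\<exists>u u'. (u, u') \<in> A\<^sub>0 \<and> f - u \<in> eigenspace ?S ?\<eta> \<and> f' = u' + ?\<eta> *\<^sub>C (f - u) \<and>
      \<Upsilon>\<^sub>1 f = \<iota>p (\<Gamma>\<^sub>1 u)" if f: "(f, f') \<in> ?S" for f f'
  proof -
    obtain u u' where u: "(u, u') \<in> A\<^sub>0" "f - u \<in> eigenspace ?S ?\<eta>" "f' = u' + ?\<eta> *\<^sub>C (f - u)"
      using resolvent_decomposition [OF \<open>?\<eta> \<in> _\<close> A0(1) Ssub f] by blast
    moreover have "first_component (Domain A\<^sub>0) (eigenspace ?S ?\<eta>) f = u"
      using first_component_eq [OF \<open>?\<eta> \<in> _\<close> A0(1,2) S] u by blast
    ultimately show ?thesis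
      by (auto simp: \<open>\<Upsilon>\<^sub>1 = _\<close>)
  qed
  have \<Upsilon>1_eq: "\<Upsilon>\<^sub>1 f = \<iota>p (\<Gamma>\<^sub>1 u)" if "(u, u') \<in> A\<^sub>0" "f - u \<in> eigenspace ?S ?\<eta>" for f u u'
    using first_component_eq [OF \<open>?\<eta> \<in> _\<close> A0(1,2) S _ that(2)] that(1)
    by (auto simp: \<open>\<Upsilon>\<^sub>1 = _\<close>)
  note E = csubspace_eigenspace [OF Ssub, of ?\<eta>]
  have A0T: "(u, u') \<in> T" if "(u, u') \<in> A\<^sub>0" for u u'
    using that by (simp add: \<open>A\<^sub>0 = _\<close> restrict_ker_iff)

  have lin0: "clinear_on (Domain ?S) \<Upsilon>\<^sub>0"
    unfolding clinear_on_def
  proof (intro conjI ballI allI)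
    fix f g assume "f \<in> Domain ?S" "g \<in> Domain ?S"
    then obtain f' g' where fg: "(f, f') \<in> ?S" "(g, g') \<in> ?S"
      by blast
    then have "(f + g, f' + g') \<in> ?S"
      using csubspaceD(2) [OF Ssub] by fastforce
    then show "\<Upsilon>\<^sub>0 (f + g) = \<Upsilon>\<^sub>0 f + \<Upsilon>\<^sub>0 g"
      by (rule \<Upsilon>0_eqI) (simp add: cinner_simps \<Upsilon>0 [OF fg(1)] \<Upsilon>0 [OF fg(2)])
  next
    fix a f assume "f \<in> Domain ?S"
    then obtain f' where f: "(f, f') \<in> ?S"
      by blast
    then have "(a *\<^sub>C f, a *\<^sub>C f') \<in> ?S"
      using csubspaceD(4) [OF Ssub] by fastforce
    then show "\<Upsilon>\<^sub>0 (a *\<^sub>C f) = a *\<^sub>C \<Upsilon>\<^sub>0 f"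
      by (rule \<Upsilon>0_eqI) (simp add: cinner_simps \<Upsilon>0 [OF f] algebra_simps)
  qed
  have lin1: "clinear_on (Domain ?S) \<Upsilon>\<^sub>1"
    unfolding clinear_on_def
  proof (intro conjI ballI allI)
    fix f g assume "f \<in> Domain ?S" "g \<in> Domain ?S"
    then obtain u u' v v' where u: "(u, u') \<in> A\<^sub>0" "f - u \<in> eigenspace ?S ?\<eta>" "\<Upsilon>\<^sub>1 f = \<iota>p (\<Gamma>\<^sub>1 u)"
      and v: "(v, v') \<in> A\<^sub>0" "g - v \<in> eigenspace ?S ?\<eta>" "\<Upsilon>\<^sub>1 g = \<iota>p (\<Gamma>\<^sub>1 v)"
      using decomp by blast
    have "(u + v, u' + v') \<in> A\<^sub>0" "(f + g) - (u + v) \<in> eigenspace ?S ?\<eta>"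
      using csubspaceD(2) [OF A0(2) u(1) v(1)] csubspaceD(2) [OF E u(2) v(2)]
      by (simp_all add: algebra_simps)
    then have "\<Upsilon>\<^sub>1 (f + g) = \<iota>p (\<Gamma>\<^sub>1 (u + v))"
      by (rule \<Upsilon>1_eq)
    also have "\<Gamma>\<^sub>1 (u + v) = \<Gamma>\<^sub>1 u + \<Gamma>\<^sub>1 v"
      using A0T u(1) v(1) by (intro clinear_onD(1) [OF qD(5)]) blast+
    finally show "\<Upsilon>\<^sub>1 (f + g) = \<Upsilon>\<^sub>1 f + \<Upsilon>\<^sub>1 g"
      using clinear_onD(1) [OF \<iota>p(1) G1 [OF u(1)] G1 [OF v(1)]] by (simp add: u(3) v(3))
  next
    fix a f assume "f \<in> Domain ?S"
    then obtain u u' where u: "(u, u') \<in> A\<^sub>0" "f - u \<in> eigenspace ?S ?\<eta>" "\<Upsilon>\<^sub>1 f = \<iota>p (\<Gamma>\<^sub>1 u)"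
      using decomp by blast
    have "(a *\<^sub>C u, a *\<^sub>C u') \<in> A\<^sub>0" "a *\<^sub>C f - a *\<^sub>C u \<in> eigenspace ?S ?\<eta>"
      using csubspaceD(4) [OF A0(2) u(1), of a] csubspaceD(4) [OF E u(2), of a]
      by (simp_all add: complex_vector.scale_right_diff_distrib)
    then have "\<Upsilon>\<^sub>1 (a *\<^sub>C f) = \<iota>p (\<Gamma>\<^sub>1 (a *\<^sub>C u))"
      by (rule \<Upsilon>1_eq)
    also have "\<Gamma>\<^sub>1 (a *\<^sub>C u) = a *\<^sub>C \<Gamma>\<^sub>1 u"
      using A0T u(1) by (intro clinear_onD(2) [OF qD(5)]) blast
    finally show "\<Upsilon>\<^sub>1 (a *\<^sub>C f) = a *\<^sub>C \<Upsilon>\<^sub>1 f"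
      using clinear_onD(2) [OF \<iota>p(1) G1 [OF u(1)]] by (simp add: u(3))
  qed

  have green: "cinner f' g - cinner f g' = cinner (\<Upsilon>\<^sub>1 f) (\<Upsilon>\<^sub>0 g) - cinner (\<Upsilon>\<^sub>0 f) (\<Upsilon>\<^sub>1 g)"
    if f: "(f, f') \<in> ?S" and g: "(g, g') \<in> ?S" for f f' g g'
  proof -
    obtain u u' where u: "(u, u') \<in> A\<^sub>0" "f' = u' + ?\<eta> *\<^sub>C (f - u)" "\<Upsilon>\<^sub>1 f = \<iota>p (\<Gamma>\<^sub>1 u)"
      using decomp [OF f] by blast
    obtain v v' where v: "(v, v') \<in> A\<^sub>0" "g' = v' + ?\<eta> *\<^sub>C (g - v)" "\<Upsilon>\<^sub>1 g = \<iota>p (\<Gamma>\<^sub>1 v)"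
      using decomp [OF g] by blast
    have "cinner u' v = cinner u v'"
      using adjoint_opD [of v v' A\<^sub>0] u(1) v(1) A0(3) by simp
    from green_identity_decomposed [OF this u(2) v(2)] show ?thesis
      using \<Upsilon>0 [OF g u(1)] \<Upsilon>0 [OF f v(1)] cinner_commute [of "\<Upsilon>\<^sub>1 f" "\<Upsilon>\<^sub>0 g"]
      by (simp add: u(3) v(3))
  qed

  have ker0: "restrict_ker ?S \<Upsilon>\<^sub>0 = A\<^sub>0"
  proof (rule set_eqI, unfold split_paired_all, rule iffI)
    fix f f' assume "(f, f') \<in> restrict_ker ?S \<Upsilon>\<^sub>0"
    then have f: "(f, f') \<in> ?S" "\<Upsilon>\<^sub>0 f = 0"
      by (auto simp: restrict_ker_iff)
    have "cinner u' f = cinner u f'" if "(u, u') \<in> A\<^sub>0" for u u'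
      using \<Upsilon>0 [OF f(1) that] cinner_commute [of f u'] cinner_commute [of f' u] by (simp add: f(2))
    then have "(f, f') \<in> adjoint_op A\<^sub>0"
      by (auto simp: adjoint_op_iff)
    then show "(f, f') \<in> A\<^sub>0"
      by (simp add: A0(3))
  next
    fix f f' assume f: "(f, f') \<in> A\<^sub>0"
    then have fS: "(f, f') \<in> ?S"
      using A0(1) by blast
    have "cinner f u' = cinner f' u" if "(u, u') \<in> A\<^sub>0" for u u'
      using adjoint_opD [of u u' A\<^sub>0 f f'] f that A0(3) by simp
    then have "\<Upsilon>\<^sub>0 f = 0"
      by (intro \<Upsilon>0_eqI [OF fS]) simp
    then show "(f, f') \<in> restrict_ker ?S \<Upsilon>\<^sub>0"
      using fS by (simp add: restrict_ker_iff)
  qed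

  have dense: "closure ((\<lambda>f. (\<Upsilon>\<^sub>0 f, \<Upsilon>\<^sub>1 f)) ` Domain ?S) = UNIV"
  proof -
    let ?R = "(\<lambda>f. (\<Upsilon>\<^sub>0 f, \<Upsilon>\<^sub>1 f)) ` Domain ?S"
    have "clinear_on (Domain ?S) (\<lambda>f. (\<Upsilon>\<^sub>0 f, \<Upsilon>\<^sub>1 f))"
      using lin0 lin1 by (simp add: clinear_on_def)
    then have R: "csubspace ?R"
      by (intro csubspace_image csubspace_Domain Ssub)
    have trivial: "q = 0" if orth: "\<And>m. m \<in> ?R \<Longrightarrow> cinner m q = 0" for q
    proof -
      obtain a b where [simp]: "q = (a, b)"
        by (cases q)
      have orth': "cinner (\<Upsilon>\<^sub>0 f) a + cinner (\<Upsilon>\<^sub>1 f) b = 0" if "f \<in> Domain ?S" for f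
        using orth that by fastforce
      obtain x y where xy: "x \<in> G\<^sub>1" "a = \<iota>p x" "y \<in> G\<^sub>1" "b = \<iota>p y"
        using \<iota>p(3) by (metis UNIV_I imageE)
      obtain u u' where u: "(u, u') \<in> A\<^sub>0" "y = \<Gamma>\<^sub>1 u"
        using G1_cases [OF xy(3)] by blast
      have "\<Upsilon>\<^sub>0 u = 0"
        using u(1) unfolding ker0 [symmetric] restrict_ker_iff by blast
      moreover have "\<Upsilon>\<^sub>1 u = b"
        using \<Upsilon>1_eq [OF u(1), of u] csubspaceD(1) [OF E] by (simp add: u(2) xy(4))
      ultimately have b: "b = 0"
        using orth' [of u] u(1) A0(1) by (auto dest!: subsetD)
      have "cinner (\<Gamma>\<^sub>0 f) x = 0" if f: "f \<in> Domain T" for f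
      proof -
        have fS: "f \<in> Domain ?S"
          using f qD(2) by blast
        have "cinner (\<Gamma>\<^sub>0 f) x = \<Gamma>\<^sub>0' f x"
          using assms(12) f xy(1) unfolding continuous_extension_def by (simp add: antidual_embed_def)
        also have "\<dots> = cinner (\<Upsilon>\<^sub>0 f) a"
          using assms(15) \<Gamma>0'_mem fS xy(1,2) by (auto simp: \<open>\<Upsilon>\<^sub>0 = _\<close>)
        finally show ?thesis
          using orth' [OF fS] by (simp add: b)
      qed
      then have "x = 0"
        using orthogonal_ran_boundary_map [OF q] by blast
      then show ?thesis
        using b clinear_on_zero [OF \<iota>p(1)] xy(1,2) by (simp add: zero_prod_def)
    qed
    have "p \<in> closure ?R" for p
      using in_closure_if_biorthogonal [OF R] trivial by (metis cinner_zero_right)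
    then show ?thesis
      by blast
  qed

  have "ordinary_boundary_triple A \<Upsilon>\<^sub>0 \<Upsilon>\<^sub>1"
    unfolding ordinary_boundary_triple_def quasi_boundary_triple_def ker0
    using S closed_adjoint_op [of A] lin0 lin1 green dense A0(4) by auto

  moreover have "is_direct_sum (restrict_ker ?S \<Upsilon>\<^sub>1) A (eigenspace_graph ?S ?\<eta>)"
    unfolding is_direct_sum_def
  proof
    have "f = 0" if "(f, ?\<eta> *\<^sub>C f) \<in> A" for f
      using that resolvent_set_inj [OF \<open>?\<eta> \<in> _\<close> _ A0(2)] A_eq restrict_ker_iff by metis
    then show "A \<inter> eigenspace_graph ?S ?\<eta> = {0}"
      using csubspaceD(1) [OF A(1)] csubspaceD(1) [OF E]
      by (force simp: eigenspace_graph_def zero_prod_def)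
    show "restrict_ker ?S \<Upsilon>\<^sub>1 = {u + v |u v. u \<in> A \<and> v \<in> eigenspace_graph ?S ?\<eta>}"
    proof (intro set_eqI iffI)
      fix p assume p: "p \<in> restrict_ker ?S \<Upsilon>\<^sub>1"
      obtain f f' where [simp]: "p = (f, f')"
        by (cases p)
      have f: "(f, f') \<in> ?S" "\<Upsilon>\<^sub>1 f = 0"
        using p by (auto simp: restrict_ker_iff)
      obtain u u' where u: "(u, u') \<in> A\<^sub>0" "f - u \<in> eigenspace ?S ?\<eta>" "f' = u' + ?\<eta> *\<^sub>C (f - u)"
          "\<Upsilon>\<^sub>1 f = \<iota>p (\<Gamma>\<^sub>1 u)"
        using decomp [OF f(1)] by blast
      have "\<iota>p (\<Gamma>\<^sub>1 u) = \<iota>p 0"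
        using u(4) f(2) clinear_on_zero [OF \<iota>p(1) csubspaceD(1) [OF G1sub]] by simp
      then have "\<Gamma>\<^sub>1 u = 0"
        using inj_onD [OF \<iota>p(2)] G1 [OF u(1)] csubspaceD(1) [OF G1sub] by blast
      then have "(u, u') \<in> A"
        using u(1) by (simp add: A_eq restrict_ker_iff)
      moreover have "(f - u, ?\<eta> *\<^sub>C (f - u)) \<in> eigenspace_graph ?S ?\<eta>"
        using u(2) by (auto simp: eigenspace_graph_def)
      moreover have "p = (u, u') + (f - u, ?\<eta> *\<^sub>C (f - u))"
        by (simp add: u(3))
      ultimately show "p \<in> {u + v |u v. u \<in> A \<and> v \<in> eigenspace_graph ?S ?\<eta>}"
        by blast
    next
      fix p assume "p \<in> {u + v |u v. u \<in> A \<and> v \<in> eigenspace_graph ?S ?\<eta>}"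
      then obtain u u' w where p: "p = (u, u') + (w, ?\<eta> *\<^sub>C w)" and u: "(u, u') \<in> A"
        and w: "w \<in> eigenspace ?S ?\<eta>"
        by (auto simp: eigenspace_graph_def)
      have u0: "(u, u') \<in> A\<^sub>0" "\<Gamma>\<^sub>1 u = 0"
        using u A_eq restrict_ker_iff by metis+
      have "p \<in> ?S"
        using A0(1) u0(1) w unfolding p by (intro csubspaceD(2) [OF Ssub]) (auto simp: in_eigenspace_iff)
      moreover have "\<Upsilon>\<^sub>1 (u + w) = 0"
        using \<Upsilon>1_eq [OF u0(1), of "u + w"] w u0(2) clinear_on_zero [OF \<iota>p(1) csubspaceD(1) [OF G1sub]]
        by simp
      ultimately show "p \<in> restrict_ker ?S \<Upsilon>\<^sub>1"
        by (simp add: p restrict_ker_iff)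
    qed
  qed
  ultimately show ?thesis
    using ker0 by blast
qed

end
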